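(* Let $S$ be a locally compact metrizable space and let $K$ be a locally compact Hausdorff space. Then, for the real spaces $C_0(S)$ and $C_0(K)$, the pair $(C_0(S),C_0(K))$ has the Bishop-Phelps-Bollobás property for operators.
   Context: $C_0(L)$ denotes here the real Banach space of real-valued continuous functions on the locally compact Hausdorff space $L$ vanishing at infinity, with the supremum norm. $S_X$ denotes the unit sphere of $X$, and $L(X,Y)$ the space of bounded linear operators. A pair $(X,Y)$ of Banach spaces has the Bishop-Phelps-Bollobás property for operators if for every $\varepsilon\in(0,1)$ there is $\eta(\varepsilon)>0$ such that for every $T_0\in L(X,Y)$ with $\|T_0\|=1$ and every $x_0\in S_X$ with $\|T_0(x_0)\|>1-\eta(\varepsilon)$, there exist $R\in L(X,Y)$ and $x\in S_X$ such that $1=\|R\|=\|Rx\|$, $\|x_0-x\|<\varepsilon$ and $\|T_0-R\|<\varepsilon$. *)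

theory Defs
  imports "HOL-Analysis.Analysis"
begin

section \<open>The real Banach space \<open>C\<^sub>0(L)\<close>\<close>

definition vanishes_at_infinity :: "('a::topological_space \<Rightarrow> real) \<Rightarrow> bool"
  where "vanishes_at_infinity f \<longleftrightarrow> (\<forall>e>0. compact {x. e \<le> \<bar>f x\<bar>})"

text \<open>
  The type is available over an arbitrary topological space, since the vector space operations and
  completeness need neither local compactness nor separation. Local compactness and the Hausdorff
  property are hypotheses of the statements that need them.
\<close>

typedef (overloaded) 'a C0 =
  "{f :: 'a::topological_space \<Rightarrow> real. continuous_on UNIV f \<and> vanishes_at_infinity f}"
  morphisms apply_C0 Abs_C0
  by (rule exI[of _ "\<lambda>_. 0"]) (simp add: vanishes_at_infinity_def)

setup_lifting type_definition_C0

lemma continuous_on_apply_C0 [simp]: "continuous_on A (apply_C0 f)"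
  using apply_C0[of f] continuous_on_subset by blast

lemma vanishes_at_infinity_apply_C0 [simp]: "vanishes_at_infinity (apply_C0 f)"
  using apply_C0[of f] by blast

lemma C0_eqI: "(\<And>x. apply_C0 f x = apply_C0 g x) \<Longrightarrow> f = g"
  by (simp add: apply_C0_inject[symmetric] fun_eq_iff)

lemma vanishes_at_infinityI:
  fixes f :: "'a::topological_space \<Rightarrow> real"
  assumes f: "continuous_on UNIV f"
    and le: "\<And>e. 0 < e \<Longrightarrow> \<exists>K. compact K \<and> {x. e \<le> \<bar>f x\<bar>} \<subseteq> K"
  shows "vanishes_at_infinity f"
  unfolding vanishes_at_infinity_def
proof (intro allI impI)
  fix e :: real assume "0 < e"
  then obtain K where K: "compact K" "{x. e \<le> \<bar>f x\<bar>} \<subseteq> K"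
    using le by blast
  have "closed {x. e \<le> \<bar>f x\<bar>}"
    by (intro closed_Collect_le continuous_intros f)
  with K(1) have "compact (K \<inter> {x. e \<le> \<bar>f x\<bar>})"
    by (rule compact_Int_closed)
  with K(2) show "compact {x. e \<le> \<bar>f x\<bar>}"
    by (simp add: inf.absorb2)
qed

lemma vanishes_at_infinity_add:
  fixes f g :: "'a::topological_space \<Rightarrow> real"
  assumes "continuous_on UNIV f" "continuous_on UNIV g"
    and v: "vanishes_at_infinity f" "vanishes_at_infinity g"
  shows "vanishes_at_infinity (\<lambda>x. f x + g x)"
proof (rule vanishes_at_infinityI)
  show "continuous_on UNIV (\<lambda>x. f x + g x)"
    using assms by (intro continuous_intros)
  fix e :: real assume "0 < e"
  then have "compact ({x. e/2 \<le> \<bar>f x\<bar>} \<union> {x. e/2 \<le> \<bar>g x\<bar>})"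
    using v half_gt_zero[of e] unfolding vanishes_at_infinity_def by (blast intro: compact_Un)
  moreover have "{x. e \<le> \<bar>f x + g x\<bar>} \<subseteq> {x. e/2 \<le> \<bar>f x\<bar>} \<union> {x. e/2 \<le> \<bar>g x\<bar>}"
  proof
    fix x assume "x \<in> {x. e \<le> \<bar>f x + g x\<bar>}"
    then have "e \<le> \<bar>f x\<bar> + \<bar>g x\<bar>"
      using abs_triangle_ineq[of "f x" "g x"] by simp
    then show "x \<in> {x. e/2 \<le> \<bar>f x\<bar>} \<union> {x. e/2 \<le> \<bar>g x\<bar>}"
      by auto
  qed
  ultimately show "\<exists>K. compact K \<and> {x. e \<le> \<bar>f x + g x\<bar>} \<subseteq> K"
    by blast
qed

lemma vanishes_at_infinity_mult:
  fixes f :: "'a::topological_space \<Rightarrow> real"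
  assumes "vanishes_at_infinity f"
  shows "vanishes_at_infinity (\<lambda>x. c * f x)"
proof (cases "c = 0")
  case True
  then show ?thesis by (simp add: vanishes_at_infinity_def)
next
  case False
  then have "{x. e \<le> \<bar>c * f x\<bar>} = {x. e / \<bar>c\<bar> \<le> \<bar>f x\<bar>}" for e
    by (simp add: abs_mult field_simps)
  with False assms show ?thesis
    by (simp add: vanishes_at_infinity_def)
qed

instantiation C0 :: (topological_space) real_vector
begin

lift_definition zero_C0 :: "'a C0" is "\<lambda>_. 0"
  by (simp add: vanishes_at_infinity_def)

lift_definition plus_C0 :: "'a C0 \<Rightarrow> 'a C0 \<Rightarrow> 'a C0" is "\<lambda>f g x. f x + g x"
  by (auto intro: vanishes_at_infinity_add continuous_intros)

lift_definition scaleR_C0 :: "real \<Rightarrow> 'a C0 \<Rightarrow> 'a C0" is "\<lambda>c f x. c * f x"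
  by (auto intro: vanishes_at_infinity_mult continuous_intros)

lift_definition uminus_C0 :: "'a C0 \<Rightarrow> 'a C0" is "\<lambda>f x. - f x"
  by (auto simp: vanishes_at_infinity_def intro: continuous_intros)

lift_definition minus_C0 :: "'a C0 \<Rightarrow> 'a C0 \<Rightarrow> 'a C0" is "\<lambda>f g x. f x - g x"
proof -
  fix f g :: "'a \<Rightarrow> real"
  assume *: "continuous_on UNIV f \<and> vanishes_at_infinity f"
    "continuous_on UNIV g \<and> vanishes_at_infinity g"
  then have "vanishes_at_infinity (\<lambda>x. f x + - g x)"
    by (intro vanishes_at_infinity_add)
      (auto simp: vanishes_at_infinity_def intro: continuous_intros)
  with * show "continuous_on UNIV (\<lambda>x. f x - g x) \<and> vanishes_at_infinity (\<lambda>x. f x - g x)"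
    by (auto intro: continuous_intros)
qed

lemmas [simp] = zero_C0.rep_eq plus_C0.rep_eq scaleR_C0.rep_eq uminus_C0.rep_eq minus_C0.rep_eq

instance
  by standard (auto intro!: C0_eqI simp: algebra_simps)

end

lemma apply_C0_in_bcontfun: "apply_C0 f \<in> bcontfun"
proof -
  have "compact {x. 1 \<le> \<bar>apply_C0 f x\<bar>}"
    using vanishes_at_infinity_apply_C0[of f] zero_less_one
    unfolding vanishes_at_infinity_def by blast
  then have "bounded (apply_C0 f ` {x. 1 \<le> \<bar>apply_C0 f x\<bar>})"
    by (intro compact_imp_bounded compact_continuous_image) simp_all
  then obtain b where b: "\<And>x. 1 \<le> \<bar>apply_C0 f x\<bar> \<Longrightarrow> \<bar>apply_C0 f x\<bar> \<le> b"
    by (auto simp: bounded_iff)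
  have "norm (apply_C0 f x) \<le> max 1 b" for x
    using b[of x] by (cases "1 \<le> \<bar>apply_C0 f x\<bar>") auto
  then show ?thesis
    by (intro bcontfun_normI) simp
qed

definition bcontfun_of_C0 :: "'a::topological_space C0 \<Rightarrow> 'a \<Rightarrow>\<^sub>C real"
  where "bcontfun_of_C0 f = Bcontfun (apply_C0 f)"

lemma apply_bcontfun_of_C0 [simp]: "apply_bcontfun (bcontfun_of_C0 f) = apply_C0 f"
  by (simp add: bcontfun_of_C0_def Bcontfun_inverse apply_C0_in_bcontfun)

lemma bcontfun_of_C0_hom:
  "bcontfun_of_C0 (f + g) = bcontfun_of_C0 f + bcontfun_of_C0 g"
  "bcontfun_of_C0 (f - g) = bcontfun_of_C0 f - bcontfun_of_C0 g"
  "bcontfun_of_C0 (c *\<^sub>R f) = c *\<^sub>R bcontfun_of_C0 f"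
  "bcontfun_of_C0 f = 0 \<longleftrightarrow> f = 0"
  by (auto intro!: bcontfun_eqI C0_eqI) (metis apply_bcontfun_of_C0 zero_bcontfun.rep_eq)

instantiation C0 :: (topological_space) real_normed_vector
begin

definition norm_C0 :: "'a C0 \<Rightarrow> real"
  where "norm_C0 f = (SUP x. \<bar>apply_C0 f x\<bar>)"

definition dist_C0 :: "'a C0 \<Rightarrow> 'a C0 \<Rightarrow> real"
  where "dist_C0 f g = norm (f - g)"

definition sgn_C0 :: "'a C0 \<Rightarrow> 'a C0"
  where "sgn_C0 f = f /\<^sub>R norm f"

definition uniformity_C0 :: "('a C0 \<times> 'a C0) filter"
  where "uniformity_C0 = (INF e\<in>{0<..}. principal {(f, g). dist f g < e})"

definition open_C0 :: "'a C0 set \<Rightarrow> bool"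
  where "open_C0 U = (\<forall>f\<in>U. \<forall>\<^sub>F (f', g) in uniformity. f' = f \<longrightarrow> g \<in> U)"

lemma norm_bcontfun_of_C0: "norm (bcontfun_of_C0 f) = norm f"
  by (simp add: norm_bcontfun_def dist_bcontfun.rep_eq norm_C0_def)

instance
proof
  fix f g :: "'a C0" and a :: real
  show "dist f g = norm (f - g)"
    by (rule dist_C0_def)
  show "sgn f = f /\<^sub>R norm f"
    by (rule sgn_C0_def)
  show "norm f = 0 \<longleftrightarrow> f = 0"
    by (simp flip: norm_bcontfun_of_C0 add: bcontfun_of_C0_hom)
  show "norm (f + g) \<le> norm f + norm g"
    by (simp flip: norm_bcontfun_of_C0 add: bcontfun_of_C0_hom norm_triangle_ineq)
  show "norm (a *\<^sub>R f) = \<bar>a\<bar> * norm f"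
    by (simp flip: norm_bcontfun_of_C0 add: bcontfun_of_C0_hom)
qed (rule uniformity_C0_def open_C0_def)+

end

lemma dist_bcontfun_of_C0: "dist (bcontfun_of_C0 f) (bcontfun_of_C0 g) = dist f g"
  by (simp add: dist_norm flip: bcontfun_of_C0_hom norm_bcontfun_of_C0)

instance C0 :: (topological_space) banach
proof
  fix F :: "nat \<Rightarrow> 'a C0"
  assume "Cauchy F"
  then have "Cauchy (\<lambda>n. bcontfun_of_C0 (F n))"
    by (simp add: Cauchy_def dist_bcontfun_of_C0)
  then obtain g where g: "uniform_limit UNIV (\<lambda>n. apply_C0 (F n)) g sequentially"
    using uniformly_convergent_eq_cauchy[of "\<lambda>_. True" "\<lambda>n. apply_C0 (F n)"]
    unfolding Cauchy_def uniform_limit_sequentially_iff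
    by (metis apply_bcontfun_of_C0 dist_fun_lt_imp_dist_val_lt)
  have cont: "continuous_on UNIV g"
    by (rule uniform_limit_theorem[OF _ g]) simp_all
  moreover have "vanishes_at_infinity g"
  proof (rule vanishes_at_infinityI[OF cont])
    fix e :: real assume e: "0 < e"
    then obtain n where n: "\<And>x. dist (apply_C0 (F n) x) (g x) < e/2"
      using uniform_limitD[OF g, of "e/2"] by (auto simp: eventually_sequentially)
    have "compact {x. e/2 \<le> \<bar>apply_C0 (F n) x\<bar>}"
      using vanishes_at_infinity_apply_C0[of "F n"] half_gt_zero[OF e]
      unfolding vanishes_at_infinity_def by blast
    moreover have "{x. e \<le> \<bar>g x\<bar>} \<subseteq> {x. e/2 \<le> \<bar>apply_C0 (F n) x\<bar>}"
    proof
      fix x assume "x \<in> {x. e \<le> \<bar>g x\<bar>}"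
      then show "x \<in> {x. e/2 \<le> \<bar>apply_C0 (F n) x\<bar>}"
        using n[of x] unfolding dist_real_def mem_Collect_eq by arith
    qed
    ultimately show "\<exists>K. compact K \<and> {x. e \<le> \<bar>g x\<bar>} \<subseteq> K"
      by blast
  qed
  ultimately have "apply_C0 (Abs_C0 g) = g"
    by (simp add: Abs_C0_inverse)
  with g have "uniform_limit UNIV (\<lambda>n. apply_bcontfun (bcontfun_of_C0 (F n)))
      (apply_bcontfun (bcontfun_of_C0 (Abs_C0 g))) sequentially"
    by simp
  then have "(\<lambda>n. bcontfun_of_C0 (F n)) \<longlonglongrightarrow> bcontfun_of_C0 (Abs_C0 g)"
    by (rule uniform_limit_tendsto_bcontfun)
  then have "F \<longlonglongrightarrow> Abs_C0 g"
    by (simp add: tendsto_iff dist_bcontfun_of_C0)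
  then show "convergent F"
    by (rule convergentI)
qed

section \<open>The Bishop-Phelps-Bollobas property for operators\<close>

definition bishop_phelps_bollobas :: "'x::banach itself \<Rightarrow> 'y::banach itself \<Rightarrow> bool"
  where "bishop_phelps_bollobas X Y \<longleftrightarrow>
    (\<forall>\<epsilon>\<in>{0<..<1::real}. \<exists>\<eta>>0. \<forall>T\<^sub>0 :: 'x \<Rightarrow>\<^sub>L 'y. \<forall>x\<^sub>0\<in>sphere 0 1.
      norm T\<^sub>0 = 1 \<and> norm (blinfun_apply T\<^sub>0 x\<^sub>0) > 1 - \<eta> \<longrightarrow>
      (\<exists>R :: 'x \<Rightarrow>\<^sub>L 'y. \<exists>x\<in>sphere 0 1.
        norm R = 1 \<and> norm (blinfun_apply R x) = 1 \<and> norm (x\<^sub>0 - x) < \<epsilon> \<and> norm (T\<^sub>0 - R) < \<epsilon>))"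

end

theory Submission
  imports Defs
begin

text \<open>
  Write \<open>C\<close> for the set where \<open>\<bar>u\<bar> = 1\<close>. Suppose that, for all \<open>t\<close> in a nonempty open set \<open>U\<close>, the
  functional \<open>f \<mapsto> T f t\<close> is at most the supremum of \<open>\<bar>f\<bar>\<close> on \<open>C\<close> alone and has value at least
  \<open>1 - \<delta>\<close> at \<open>u\<close>. In terms of the measure \<open>\<mu>\<^sub>t\<close> representing this functional: \<open>\<mu>\<^sub>t\<close> is
  concentrated on \<open>C\<close>, has norm at most one, and \<open>u \<mu>\<^sub>t\<close> is positive up to a part of mass about
  \<open>\<delta>\<close>. The predicate \<open>almost_peaks u \<delta> T U\<close> records this.

  The core of the proof is that such a \<open>T\<close> can be moved by \<open>O(\<delta>)\<close> so that the same holds with \<open>\<delta>/2\<close>,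
  the same \<open>u\<close>, and a smaller \<open>U\<close> (\<open>almost_peaks_improve\<close>). One removes the negative part of
  \<open>u \<mu>\<^sub>t\<close> by a continuous density \<open>h\<close> and rescales. The difficulty is that one \<open>h\<close> has to serve for
  all \<open>t\<close> in an open set, although the negative part of \<open>u \<mu>\<^sub>t\<close> does not depend continuously on
  \<open>t\<close>. It is overcome by choosing \<open>t\<close> where the norm of the functional is almost the supremum over
  \<open>U\<close>, say witnessed by \<open>w\<close>: then \<open>w\<close> is almost norming for all functionals near \<open>t\<close>, and the
  positive part of \<open>u w\<close> serves as an approximate Hahn decomposition for all of them at once.
  Iterating, the changes form a geometric series, and the limit operator \<open>R\<close> has norm at most one
  and satisfies \<open>\<parallel>R u\<parallel> \<ge> 1\<close> (\<open>almost_peaks_limit\<close>).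

  To get started, let \<open>T f t\<close> be close to \<open>1\<close>. Then the functionals near \<open>t\<close> are concentrated
  where \<open>\<bar>f\<bar>\<close> is close to \<open>1\<close>; truncating \<open>f\<close> makes its modulus equal to \<open>1\<close> there
  (\<open>almost_peaks_start\<close>). Everything is phrased with operators and test functions, and measures
  serve only as a guide: to bound a functional on \<open>g\<close> one adds to \<open>g\<close> a function on which the
  functional is known to be almost maximal without making the modulus on \<open>C\<close> exceed \<open>1\<close>.
\<close>

section \<open>Norms and multiplication operators on \<open>C\<^sub>0(L)\<close>\<close>

lemma abs_apply_C0_le_norm: "\<bar>apply_C0 f x\<bar> \<le> norm f"
  using norm_bounded[of "bcontfun_of_C0 f" x] by (simp add: norm_bcontfun_of_C0)

lemma norm_C0_leI: "(\<And>x. \<bar>apply_C0 f x\<bar> \<le> B) \<Longrightarrow> norm f \<le> B"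
  unfolding norm_C0_def by (rule cSUP_least) auto

lemma norm_blinfun_C0_leI:
  fixes T :: "'a::real_normed_vector \<Rightarrow>\<^sub>L 'k::topological_space C0"
  assumes B: "0 \<le> B" and le: "\<And>v t. norm v \<le> 1 \<Longrightarrow> \<bar>apply_C0 (T v) t\<bar> \<le> B"
  shows "norm T \<le> B"
proof (rule norm_blinfun_bound[OF B])
  fix v :: 'a
  have unit: "norm (T (v /\<^sub>R norm v)) \<le> B"
    by (intro norm_C0_leI le) (cases "v = 0"; simp)
  show "norm (T v) \<le> B * norm v"
  proof (cases "v = 0")
    case False
    have "norm (T (v /\<^sub>R norm v)) = norm (T v) / norm v"
      by (simp add: blinfun.scaleR_right divide_inverse mult.commute)
    with unit False show ?thesis
      by (simp add: divide_le_eq)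
  qed (simp add: blinfun.zero_right)
qed

lemma multiplication_operator:
  fixes h :: "'a::topological_space \<Rightarrow> real"
  assumes h: "continuous_on UNIV h" and B: "\<And>x. \<bar>h x\<bar> \<le> B"
  obtains M :: "'a C0 \<Rightarrow>\<^sub>L 'a C0" where "\<And>f x. apply_C0 (M f) x = h x * apply_C0 f x"
proof -
  define m where "m f = Abs_C0 (\<lambda>x. h x * apply_C0 f x)" for f
  define b where "b = max 1 B"
  have b: "0 < b" "\<And>x. \<bar>h x\<bar> \<le> b"
    using B by (auto simp: b_def intro: max.coboundedI2)
  have m: "apply_C0 (m f) = (\<lambda>x. h x * apply_C0 f x)" for f
    unfolding m_def
  proof (rule Abs_C0_inverse, rule CollectI, rule conjI)
    show cont: "continuous_on UNIV (\<lambda>x. h x * apply_C0 f x)"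
      by (intro continuous_intros h) simp
    show "vanishes_at_infinity (\<lambda>x. h x * apply_C0 f x)"
    proof (rule vanishes_at_infinityI[OF cont])
      fix e :: real assume "0 < e"
      with b(1) have "compact {x. e / b \<le> \<bar>apply_C0 f x\<bar>}"
        using vanishes_at_infinity_apply_C0[of f] unfolding vanishes_at_infinity_def
        by (meson divide_pos_pos)
      moreover have "e / b \<le> \<bar>apply_C0 f x\<bar>" if "e \<le> \<bar>h x * apply_C0 f x\<bar>" for x
      proof -
        have "\<bar>h x\<bar> * \<bar>apply_C0 f x\<bar> \<le> b * \<bar>apply_C0 f x\<bar>"
          by (intro mult_right_mono b) simp
        with that b(1) show ?thesis
          by (simp add: abs_mult divide_le_eq mult.commute)
      qed
      ultimately show "\<exists>K. compact K \<and> {x. e \<le> \<bar>h x * apply_C0 f x\<bar>} \<subseteq> K"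
        by blast
    qed
  qed
  have "bounded_linear m"
  proof (rule bounded_linear_intro)
    show "norm (m f) \<le> norm f * b" for f
    proof (rule norm_C0_leI)
      fix x
      have "\<bar>h x\<bar> * \<bar>apply_C0 f x\<bar> \<le> b * norm f"
        using b by (intro mult_mono abs_apply_C0_le_norm) auto
      then show "\<bar>apply_C0 (m f) x\<bar> \<le> norm f * b"
        by (simp add: m abs_mult mult.commute)
    qed
  qed (auto intro!: C0_eqI simp: m algebra_simps)
  with m have "apply_C0 (blinfun_apply (Blinfun m) f) x = h x * apply_C0 f x" for f x
    by (simp add: bounded_linear_Blinfun_apply)
  with that show thesis .
qed

section \<open>Changing an operator near a point\<close>

lemma locally_compact_bump:
  fixes U :: "'k::t2_space set"
  assumes "locally_compact_space (euclidean :: 'k topology)" "open U" "t \<in> U"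
  obtains g :: "'k \<Rightarrow> real" and V where "continuous_on UNIV g" "\<And>x. 0 \<le> g x" "\<And>x. g x \<le> 1"
    "\<And>x. x \<notin> U \<Longrightarrow> g x = 0" "open V" "t \<in> V" "V \<subseteq> U" "\<And>x. x \<in> V \<Longrightarrow> g x = 1"
proof -
  have "Hausdorff_space (euclidean :: 'k topology)"
    unfolding Hausdorff_space_def disjnt_def by (metis hausdorff open_openin)
  with assms(1) have "completely_regular_space (euclidean :: 'k topology)"
    by (metis locally_compact_Hausdorff_imp_regular_space
        locally_compact_regular_imp_completely_regular_space)
  with assms(2,3) obtain f :: "'k \<Rightarrow> real"
    where "continuous_map euclidean (top_of_set {0..1}) f" "f t = 0" "f ` (- U) \<subseteq> {1}"
    unfolding completely_regular_space_def closedin_def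
    by (metis (no_types, lifting) Compl_eq_Diff_UNIV DiffI UNIV_I closed_Compl closed_closedin
        closedin_def topspace_euclidean ComplD)
  then have f: "continuous_on UNIV f" "\<And>x. 0 \<le> f x" "\<And>x. f x \<le> 1" "f t = 0"
    "\<And>x. x \<notin> U \<Longrightarrow> f x = 1"
    by (auto simp: continuous_map_in_subtopology image_subset_iff)
  \<comment> \<open>Doubling and truncating makes the bump constant near \<open>t\<close>, not only maximal at \<open>t\<close>.\<close>
  show thesis
  proof (rule that[of "\<lambda>x. min 1 (2 * (1 - f x))" "{x. f x < 1/2}"])
    show "continuous_on UNIV (\<lambda>x. min 1 (2 * (1 - f x)))"
      by (intro continuous_intros f)
    show "open {x. f x < 1/2}"
      by (intro open_Collect_less continuous_intros f)
    show "{x. f x < 1/2} \<subseteq> U"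
      using f(5) by force
  qed (use f in auto)
qed

text \<open>
  The replacement is \<open>(1 - g) T + g A\<close> with a bump function \<open>g\<close> on the target space. At every point
  it is a convex combination, so the norm bound survives.
\<close>
lemma replace_operator_locally:
  fixes T A :: "'a::real_normed_vector \<Rightarrow>\<^sub>L 'k::t2_space C0"
  assumes lc: "locally_compact_space (euclidean :: 'k topology)" and U: "open U" "t \<in> U"
    and T: "norm T \<le> 1" and d: "0 \<le> d"
    and A: "\<And>v s. norm v \<le> 1 \<Longrightarrow> s \<in> U \<Longrightarrow> \<bar>apply_C0 (A v) s\<bar> \<le> 1"
    and AT: "\<And>v s. norm v \<le> 1 \<Longrightarrow> s \<in> U \<Longrightarrow> \<bar>apply_C0 (A v) s - apply_C0 (T v) s\<bar> \<le> d"
  obtains T' :: "'a \<Rightarrow>\<^sub>L 'k C0" and V where "norm T' \<le> 1" "norm (T' - T) \<le> d"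
    "open V" "t \<in> V" "V \<subseteq> U" "\<And>v s. s \<in> V \<Longrightarrow> apply_C0 (T' v) s = apply_C0 (A v) s"
proof -
  obtain g :: "'k \<Rightarrow> real" and V where g: "continuous_on UNIV g" "\<And>x. 0 \<le> g x" "\<And>x. g x \<le> 1"
      "\<And>x. x \<notin> U \<Longrightarrow> g x = 0" and V: "open V" "t \<in> V" "V \<subseteq> U" "\<And>x. x \<in> V \<Longrightarrow> g x = 1"
    using locally_compact_bump[OF lc U] by blast
  have "\<bar>g x\<bar> \<le> 1" for x
    using g(2,3)[of x] by simp
  then obtain M :: "'k C0 \<Rightarrow>\<^sub>L 'k C0" where M: "\<And>f x. apply_C0 (M f) x = g x * apply_C0 f x"
    using multiplication_operator[OF g(1)] by blast
  define T' where "T' = T + (M o\<^sub>L (A - T))"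
  have T': "apply_C0 (T' v) s = apply_C0 (T v) s + g s * (apply_C0 (A v) s - apply_C0 (T v) s)"
    for v s
    by (simp add: T'_def M blinfun.add_left blinfun.diff_left)
  show thesis
  proof (rule that[of T' V])
    show "norm T' \<le> 1"
    proof (rule norm_blinfun_C0_leI)
      fix v :: 'a and s assume v: "norm v \<le> 1"
      have Tv: "\<bar>apply_C0 (T v) s\<bar> \<le> 1"
        using abs_apply_C0_le_norm[of "T v" s] norm_blinfun[of T v] mult_mono[OF T v] by simp
      show "\<bar>apply_C0 (T' v) s\<bar> \<le> 1"
      proof (cases "s \<in> U")
        case True
        have "apply_C0 (T' v) s = (1 - g s) * apply_C0 (T v) s + g s * apply_C0 (A v) s"
          by (simp add: T' algebra_simps)
        also have "\<bar>\<dots>\<bar> \<le> (1 - g s) * 1 + g s * 1"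
          using g(2,3)[of s] Tv A[OF v True]
          by (intro order_trans[OF abs_triangle_ineq] add_mono)
            (auto simp: abs_mult intro!: mult_left_le)
        finally show ?thesis by simp
      qed (use Tv g(4) in \<open>simp add: T'\<close>)
    qed simp
    show "norm (T' - T) \<le> d"
    proof (rule norm_blinfun_C0_leI[OF d])
      fix v :: 'a and s assume v: "norm v \<le> 1"
      show "\<bar>apply_C0 ((T' - T) v) s\<bar> \<le> d"
      proof (cases "s \<in> U")
        case True
        have "\<bar>g s\<bar> * \<bar>apply_C0 (A v) s - apply_C0 (T v) s\<bar> \<le> 1 * d"
          using g(2,3)[of s] AT[OF v True] by (intro mult_mono) auto
        then show ?thesis by (simp add: T' blinfun.diff_left abs_mult)
      qed (use d g(4) in \<open>simp add: T' blinfun.diff_left\<close>)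
    qed
  qed (use V T' in auto)
qed

section \<open>Operators that almost peak at a function\<close>

text \<open>
  The last clause bounds \<open>T f t\<close> by the values of \<open>f\<close> on \<open>{x. \<bar>u x\<bar> = 1}\<close>; applied to multiples of \<open>f\<close>
  it also yields that \<open>T f t = 0\<close> whenever \<open>f\<close> vanishes on that set. So it says that the functional
  at \<open>t\<close> is carried by that set and has norm at most one.
\<close>
definition almost_peaks ::
    "'s::topological_space C0 \<Rightarrow> real \<Rightarrow> ('s C0 \<Rightarrow>\<^sub>L 'k::topological_space C0) \<Rightarrow> 'k set \<Rightarrow> bool"
  where "almost_peaks u \<delta> T U \<longleftrightarrow> norm T \<le> 1 \<and> open U \<and> U \<noteq> {} \<and>
    (\<forall>t\<in>U. 1 - \<delta> \<le> apply_C0 (T u) t) \<and>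
    (\<forall>t\<in>U. \<forall>f. (\<forall>x. \<bar>apply_C0 u x\<bar> = 1 \<longrightarrow> \<bar>apply_C0 f x\<bar> \<le> 1) \<longrightarrow> apply_C0 (T f) t \<le> 1)"

text \<open>
  The function \<open>u\<close> is \<open>f\<close> divided by \<open>1 - \<rho>\<close> and truncated to \<open>[-1, 1]\<close>, so that \<open>\<bar>u\<bar> = 1\<close> where
  \<open>\<bar>f\<bar> \<ge> 1 - \<rho>\<close>. Near \<open>t\<close> the operator is composed with multiplication by a function \<open>h\<close> supported
  there. Little is lost, because \<open>\<bar>f\<bar> + \<rho> (1 - h) \<le> 1\<close>: as \<open>T f s > 1 - \<rho>\<^sup>2\<close>, the functional at \<open>s\<close>
  has norm at most \<open>\<rho>\<close> on functions dominated by \<open>1 - h\<close>.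
\<close>
lemma almost_peaks_start:
  fixes T :: "'s::topological_space C0 \<Rightarrow>\<^sub>L 'k::t2_space C0" and f :: "'s C0"
  assumes lc: "locally_compact_space (euclidean :: 'k topology)" and T: "norm T \<le> 1"
    and f: "norm f \<le> 1" and \<rho>: "0 < \<rho>" "\<rho> < 1" and Tf: "1 - \<rho>\<^sup>2 < apply_C0 (T f) t"
  obtains u T' U where "norm u \<le> 1" "norm (f - u) \<le> \<rho>" "norm (T' - T) \<le> \<rho>"
    "almost_peaks u (3 * \<rho>) T' U"
proof -
  note [simp] = blinfun.add_right blinfun.diff_right blinfun.scaleR_right
  have fx: "\<bar>apply_C0 f x\<bar> \<le> 1" for x
    using abs_apply_C0_le_norm[of f x] f by simp
  have Tle: "apply_C0 (T v) s \<le> 1" if "\<And>x. \<bar>apply_C0 v x\<bar> \<le> 1" for v s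
  proof -
    have "norm (T v) \<le> 1"
      using norm_blinfun[of T v] mult_mono[OF T norm_C0_leI[OF that]] by simp
    then show ?thesis using abs_apply_C0_le_norm[of "T v" s] by simp
  qed
  \<comment> \<open>Dividing by \<open>max (1 - \<rho>) \<bar>f\<bar>\<close> is the truncation of \<open>f / (1 - \<rho>)\<close>, written as a multiplication
    operator so that \<open>u\<close> vanishes at infinity.\<close>
  define m where "m x = 1 / max (1 - \<rho>) \<bar>apply_C0 f x\<bar>" for x
  have m_cont: "continuous_on UNIV m"
    unfolding m_def using \<rho> by (intro continuous_intros) auto
  have m_bound: "\<bar>m x\<bar> \<le> 1 / (1 - \<rho>)" for x
    using \<rho> by (auto simp: m_def intro!: divide_left_mono)
  obtain M :: "'s C0 \<Rightarrow>\<^sub>L 's C0" where M: "\<And>v x. apply_C0 (M v) x = m x * apply_C0 v x"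
    using multiplication_operator[OF m_cont m_bound] by blast
  define u where "u = M f"
  have ux: "apply_C0 u x = apply_C0 f x / max (1 - \<rho>) \<bar>apply_C0 f x\<bar>" for x
    by (simp add: u_def M m_def)
  have u_le: "\<bar>apply_C0 u x\<bar> \<le> 1" for x
    using \<rho> by (simp add: ux divide_le_eq abs_divide)
  have u_eq: "\<bar>apply_C0 u x\<bar> = 1" if "1 - \<rho> \<le> \<bar>apply_C0 f x\<bar>" for x
    using that \<rho> by (auto simp: ux abs_divide max_def)
  have fu: "\<bar>apply_C0 f x - apply_C0 u x\<bar> \<le> \<rho>" for x
  proof -
    define q where "q = max (1 - \<rho>) \<bar>apply_C0 f x\<bar>"
    have q: "0 < q" "1 - \<rho> \<le> q" "\<bar>apply_C0 f x\<bar> \<le> q" "q \<le> 1"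
      using \<rho> fx[of x] by (auto simp: q_def)
    have "apply_C0 f x - apply_C0 u x = - ((1 - q) * (apply_C0 f x / q))"
      using q(1) by (simp add: ux q_def[symmetric] field_simps)
    then have "\<bar>apply_C0 f x - apply_C0 u x\<bar> = (1 - q) * (\<bar>apply_C0 f x\<bar> / q)"
      using q by (simp add: abs_mult)
    also have "\<dots> \<le> (1 - q) * 1"
      using q by (intro mult_left_mono) auto
    finally show ?thesis using q(2) by simp
  qed
  define h where "h x = max 0 ((\<bar>apply_C0 f x\<bar> - (1 - \<rho>)) / \<rho>)" for x
  have h: "continuous_on UNIV h" "\<And>x. 0 \<le> h x" "\<And>x. h x \<le> 1" "\<And>x. \<bar>h x\<bar> \<le> 1"
    "\<And>x. \<bar>apply_C0 u x\<bar> \<noteq> 1 \<Longrightarrow> h x = 0"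
  proof -
    show "continuous_on UNIV h"
      unfolding h_def using \<rho> by (intro continuous_intros) auto
    show 0: "0 \<le> h x" and 1: "h x \<le> 1" for x
      using \<rho> fx[of x] by (auto simp: h_def divide_le_eq)
    show "\<bar>h x\<bar> \<le> 1" for x using 0[of x] 1[of x] by simp
    show "h x = 0" if "\<bar>apply_C0 u x\<bar> \<noteq> 1" for x
    proof -
      have "\<bar>apply_C0 f x\<bar> < 1 - \<rho>" using that u_eq[of x] by linarith
      then show ?thesis using \<rho> by (auto simp: h_def max_def zero_le_divide_iff)
    qed
  qed
  obtain H :: "'s C0 \<Rightarrow>\<^sub>L 's C0" where H: "\<And>v x. apply_C0 (H v) x = h x * apply_C0 v x"
    using multiplication_operator[OF h(1,4)] by blast
  define U where "U = {s. 1 - \<rho>\<^sup>2 < apply_C0 (T f) s}"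
  have U: "open U" "t \<in> U"
    using Tf by (auto simp: U_def intro!: open_Collect_less continuous_intros)
  have near: "apply_C0 (T v) s - apply_C0 (T (H v)) s \<le> \<rho>"
    if v: "\<And>x. \<bar>apply_C0 v x\<bar> \<le> 1" and s: "s \<in> U" for v s
  proof -
    have "\<bar>apply_C0 (f + \<rho> *\<^sub>R (v - H v)) x\<bar> \<le> 1" for x
    proof -
      have "\<rho> * \<bar>(1 - h x) * apply_C0 v x\<bar> \<le> \<rho> * (1 - h x)"
        using \<rho> h(3)[of x] v[of x] by (auto simp: abs_mult intro!: mult_left_mono mult_left_le)
      also have "\<dots> \<le> 1 - \<bar>apply_C0 f x\<bar>"
        using \<rho> by (simp add: h_def max_def field_simps)
      finally have "\<bar>apply_C0 f x\<bar> + \<bar>\<rho> * ((1 - h x) * apply_C0 v x)\<bar> \<le> 1"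
        using \<rho> by (simp add: abs_mult)
      then have "\<bar>apply_C0 f x + \<rho> * ((1 - h x) * apply_C0 v x)\<bar> \<le> 1"
        by linarith
      then show ?thesis by (simp add: H algebra_simps)
    qed
    from Tle[OF this, of s] have "apply_C0 (T f) s + \<rho> * (apply_C0 (T v) s - apply_C0 (T (H v)) s) \<le> 1"
      by simp
    with s have "\<rho> * (apply_C0 (T v) s - apply_C0 (T (H v)) s) \<le> \<rho> * \<rho>"
      by (simp add: U_def power2_eq_square)
    with \<rho> show ?thesis by simp
  qed
  have TH: "apply_C0 (T (H v)) s \<le> 1"
    if "\<And>x. \<bar>apply_C0 u x\<bar> = 1 \<Longrightarrow> \<bar>apply_C0 v x\<bar> \<le> 1" for v s
  proof (rule Tle)
    show "\<bar>apply_C0 (H v) x\<bar> \<le> 1" for x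
      using that[of x] h(4,5)[of x]
      by (cases "\<bar>apply_C0 u x\<bar> = 1") (auto simp: H abs_mult intro: mult_le_one)
  qed
  have unit: "\<bar>apply_C0 v x\<bar> \<le> 1" if "norm v \<le> 1" for v :: "'s C0" and x
    using abs_apply_C0_le_norm[of v x] that by simp
  obtain T' V where T': "norm T' \<le> 1" "norm (T' - T) \<le> \<rho>" "open V" "t \<in> V" "V \<subseteq> U"
    "\<And>v s. s \<in> V \<Longrightarrow> apply_C0 (T' v) s = apply_C0 ((T o\<^sub>L H) v) s"
  proof (rule replace_operator_locally[OF lc U T, of \<rho> "T o\<^sub>L H"])
    fix v :: "'s C0" and s assume v: "norm v \<le> 1" and s: "s \<in> U"
    show "\<bar>apply_C0 ((T o\<^sub>L H) v) s\<bar> \<le> 1"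
      using TH[of v s] TH[of "- v" s] unit[OF v] by (simp add: blinfun.minus_right)
    show "\<bar>apply_C0 ((T o\<^sub>L H) v) s - apply_C0 (T v) s\<bar> \<le> \<rho>"
      using near[of v s] near[of "- v" s] unit[OF v] s by (simp add: blinfun.minus_right)
  qed (use \<rho> in auto)
  have "almost_peaks u (3 * \<rho>) T' V"
    unfolding almost_peaks_def
  proof (intro conjI ballI allI impI)
    show "V \<noteq> {}" using T'(4) by blast
    fix s assume s: "s \<in> V"
    then have sU: "s \<in> U" using T'(5) by blast
    have "\<bar>apply_C0 ((1 / \<rho>) *\<^sub>R (f - u)) x\<bar> \<le> 1" for x
      using fu[of x] \<rho> by (simp add: abs_divide)
    from Tle[OF this, of s] have "apply_C0 (T f) s - apply_C0 (T u) s \<le> \<rho>"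
      using \<rho> by (simp add: divide_le_eq)
    moreover have "\<rho>\<^sup>2 \<le> \<rho>"
      using \<rho> by (simp add: power2_eq_square)
    ultimately show "1 - 3 * \<rho> \<le> apply_C0 (T' u) s"
      using near[of u s] u_le sU T'(6)[OF s, of u] by (simp add: U_def)
    fix v :: "'s C0" assume "\<forall>x. \<bar>apply_C0 u x\<bar> = 1 \<longrightarrow> \<bar>apply_C0 v x\<bar> \<le> 1"
    then show "apply_C0 (T' v) s \<le> 1"
      using TH[of v s] T'(6)[OF s, of v] by simp
  qed (use T' in auto)
  moreover have "norm u \<le> 1" "norm (f - u) \<le> \<rho>"
    using u_le fu by (auto intro!: norm_C0_leI)
  ultimately show thesis using T'(2) that by blast
qed

text \<open>
  Let \<open>c\<close> be the supremum of the norms of the functionals at points of \<open>U\<close>, and choose \<open>t \<in> U\<close> and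
  \<open>w\<close> with \<open>T w t > c - \<gamma>\<close>. By continuity \<open>T w s > c - \<gamma>\<close> for \<open>s\<close> near \<open>t\<close>, while no functional
  at such an \<open>s\<close> has norm above \<open>c\<close>. With \<open>h = (u w)\<^sup>+\<close> one has \<open>w = h u - (u w)\<^sup>- u\<close> on
  \<open>C\<close>, and replacing \<open>h u\<close> by \<open>h v\<close> for an arbitrary admissible \<open>v\<close> keeps the modulus at most \<open>1\<close>. Hence
  \<open>T (h v) s \<le> T (h u) s + \<gamma>\<close>: the functional \<open>v \<mapsto> T (h v) s\<close> almost attains its norm at \<open>u\<close>, with an
  error \<open>\<gamma>\<close> that can be chosen at will. Since \<open>T (h u) s\<close> depends continuously on \<open>s\<close>, a single
  constant \<open>b\<close> normalises all these functionals.
\<close>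
lemma almost_peaks_improve:
  fixes T :: "'s::topological_space C0 \<Rightarrow>\<^sub>L 'k::t2_space C0"
  assumes lc: "locally_compact_space (euclidean :: 'k topology)"
    and T: "almost_peaks u \<delta> T U" and \<delta>: "0 < \<delta>" "\<delta> \<le> 1/6"
  obtains T' V where "norm (T' - T) \<le> 4 * \<delta>" "almost_peaks u (\<delta> / 2) T' V"
proof -
  note [simp] = blinfun.add_right blinfun.diff_right blinfun.scaleR_right
  define adm where "adm v \<longleftrightarrow> (\<forall>x. \<bar>apply_C0 u x\<bar> = 1 \<longrightarrow> \<bar>apply_C0 v x\<bar> \<le> 1)" for v :: "'s C0"
  have unit: "adm v" if "norm v \<le> 1" for v
    using that abs_apply_C0_le_norm[of v] unfolding adm_def by (meson order_trans)
  have U: "norm T \<le> 1" "open U" "U \<noteq> {}" "\<And>t. t \<in> U \<Longrightarrow> 1 - \<delta> \<le> apply_C0 (T u) t"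
    "\<And>t v. t \<in> U \<Longrightarrow> adm v \<Longrightarrow> apply_C0 (T v) t \<le> 1"
    using T unfolding almost_peaks_def adm_def by blast+
  \<comment> \<open>After normalisation the error is at most \<open>3 \<gamma> / b\<close> with \<open>b \<ge> 1/2\<close>, which has to be at most
    \<open>\<delta> / 2\<close>.\<close>
  define \<gamma> where "\<gamma> = \<delta> / 12"
  have \<gamma>: "0 < \<gamma>" using \<delta> by (simp add: \<gamma>_def)
  define Q where "Q = (\<lambda>(t, v). apply_C0 (T v) t) ` (U \<times> Collect adm)"
  define c where "c = Sup Q"
  have adm_u: "adm u" by (simp add: adm_def)
  have bdd: "bdd_above Q" using U(5) by (auto simp: Q_def intro!: bdd_aboveI[of _ 1])
  have le_c: "apply_C0 (T v) t \<le> c" if "t \<in> U" "adm v" for t v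
    unfolding c_def using that by (intro cSup_upper bdd) (auto simp: Q_def)
  have "Q \<noteq> {}" using U(3) adm_u by (auto simp: Q_def)
  then obtain q where "q \<in> Q" "c - \<gamma> < q"
    using less_cSupE[of "c - \<gamma>" Q] \<gamma> by (auto simp: c_def)
  then obtain t w where t: "t \<in> U" and w: "adm w" and tw: "c - \<gamma> < apply_C0 (T w) t"
    by (auto simp: Q_def)
  have c: "1 - \<delta> \<le> c" using U(4)[OF t] le_c[OF t adm_u] by simp
  define h where "h x = max 0 (apply_C0 u x * apply_C0 w x)" for x
  have h_cont: "continuous_on UNIV h" unfolding h_def by (intro continuous_intros) auto
  have h_bound: "\<bar>h x\<bar> \<le> norm u * norm w" for x
  proof -
    have "\<bar>apply_C0 u x\<bar> * \<bar>apply_C0 w x\<bar> \<le> norm u * norm w"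
      by (intro mult_mono abs_apply_C0_le_norm) auto
    then show ?thesis
      by (simp add: h_def abs_mult[symmetric])
  qed
  obtain H :: "'s C0 \<Rightarrow>\<^sub>L 's C0" where H: "\<And>v x. apply_C0 (H v) x = h x * apply_C0 v x"
    using multiplication_operator[OF h_cont h_bound] by blast
  have on_C: "0 \<le> h x" "h x \<le> 1" "\<bar>apply_C0 w x\<bar> \<le> 1"
    "apply_C0 w x = h x * apply_C0 u x \<or> h x = 0 \<and> apply_C0 u x * apply_C0 w x \<le> 0"
    if "\<bar>apply_C0 u x\<bar> = 1" for x
  proof -
    show wx: "\<bar>apply_C0 w x\<bar> \<le> 1" using w that by (simp add: adm_def)
    from that consider "apply_C0 u x = 1" | "apply_C0 u x = -1" by linarith
    then have "0 \<le> h x \<and> h x \<le> 1 \<and>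
      (apply_C0 w x = h x * apply_C0 u x \<or> h x = 0 \<and> apply_C0 u x * apply_C0 w x \<le> 0)"
      by cases (use wx in \<open>auto simp: h_def max_def\<close>)
    then show "0 \<le> h x" "h x \<le> 1"
      "apply_C0 w x = h x * apply_C0 u x \<or> h x = 0 \<and> apply_C0 u x * apply_C0 w x \<le> 0"
      by simp_all
  qed
  have convex: "\<bar>(y - r * y) + r * z\<bar> \<le> 1"
    if "\<bar>y\<bar> \<le> 1" "\<bar>z\<bar> \<le> 1" "0 \<le> r" "r \<le> 1" for y z r :: real
  proof -
    have "\<bar>(1 - r) * y + r * z\<bar> \<le> (1 - r) * 1 + r * 1"
      using that by (intro order_trans[OF abs_triangle_ineq] add_mono)
        (auto simp: abs_mult intro!: mult_left_le)
    then show ?thesis by (simp add: algebra_simps)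
  qed
  \<comment> \<open>The test functions: \<open>adm1\<close> shows that \<open>H u\<close> is almost optimal among all \<open>H v\<close>, \<open>adm2\<close> that
    \<open>T (H u) t\<close> is close to one, and \<open>adm3\<close> that the operator loses little by passing from \<open>v\<close> to
    \<open>H v\<close>.\<close>
  define a where "a s = apply_C0 (T (H u)) s" for s
  have adm_H: "adm (H v)" if "adm v" for v
    unfolding adm_def
  proof (intro allI impI)
    fix x assume x: "\<bar>apply_C0 u x\<bar> = 1"
    then have "\<bar>apply_C0 v x\<bar> \<le> 1" using that by (simp add: adm_def)
    with convex[of 0 "apply_C0 v x" "h x"] on_C[OF x] show "\<bar>apply_C0 (H v) x\<bar> \<le> 1"
      by (simp add: H)
  qed
  have adm1: "adm (H v + (w - H u))" if "adm v" for v
    unfolding adm_def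
  proof (intro allI impI)
    fix x assume x: "\<bar>apply_C0 u x\<bar> = 1"
    then have "\<bar>apply_C0 (H v) x\<bar> \<le> 1" using adm_H[OF that] by (simp add: adm_def)
    with on_C[OF x] show "\<bar>apply_C0 (H v + (w - H u)) x\<bar> \<le> 1"
      by (auto simp: H)
  qed
  have adm2: "adm (u + 2 *\<^sub>R w - 2 *\<^sub>R H u)"
    unfolding adm_def
  proof (intro allI impI)
    fix x assume x: "\<bar>apply_C0 u x\<bar> = 1"
    from on_C(4)[OF x] show "\<bar>apply_C0 (u + 2 *\<^sub>R w - 2 *\<^sub>R H u) x\<bar> \<le> 1"
    proof
      assume "apply_C0 w x = h x * apply_C0 u x"
      with x show ?thesis by (simp add: H)
    next
      assume neg: "h x = 0 \<and> apply_C0 u x * apply_C0 w x \<le> 0"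
      from x consider "apply_C0 u x = 1" | "apply_C0 u x = -1" by linarith
      then show ?thesis
        by cases (use neg on_C(3)[OF x] in \<open>simp_all add: H abs_le_iff\<close>)
    qed
  qed
  have adm3: "adm ((v - H v) + H u)" if "adm v" for v
    unfolding adm_def
  proof (intro allI impI)
    fix x assume x: "\<bar>apply_C0 u x\<bar> = 1"
    then have "\<bar>apply_C0 v x\<bar> \<le> 1" using that by (simp add: adm_def)
    with convex[of "apply_C0 v x" "apply_C0 u x" "h x"] on_C[OF x] x
    show "\<bar>apply_C0 ((v - H v) + H u) x\<bar> \<le> 1"
      by (simp add: H)
  qed
  define W where "W = U \<inter> {s. c - \<gamma> < apply_C0 (T w) s} \<inter> {s. a s < a t + \<gamma>} \<inter> {s. a t - \<gamma> < a s}"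
  have W: "open W" "t \<in> W"
    using U(2) t tw \<gamma> by (auto simp: W_def a_def intro!: open_Int open_Collect_less continuous_intros)
  have WD: "s \<in> U" "c - \<gamma> < apply_C0 (T w) s" "a s < a t + \<gamma>" "a t - \<gamma> < a s" if "s \<in> W" for s
    using that by (auto simp: W_def)
  define b where "b = a t + 2 * \<gamma>"
  have a_lower: "1 - 3/2 * \<delta> - \<gamma> \<le> a t"
    using U(5)[OF t adm2] U(4)[OF t] tw c by (simp add: a_def)
  have a_upper: "a t \<le> 1"
    unfolding a_def by (intro U(5) t adm_H adm_u)
  have b: "1/2 \<le> b" "1 - 3/2 * \<delta> \<le> b" "b \<le> 1 + 2 * \<gamma>"
    using a_lower a_upper \<delta> by (auto simp: b_def \<gamma>_def)
  have TH: "apply_C0 (T (H v)) s \<le> b" if "adm v" "s \<in> W" for v s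
    using le_c[OF WD(1) adm1, of s v] WD[of s] that by (simp add: a_def b_def)
  have near: "apply_C0 (T v) s - apply_C0 (T (H v)) s \<le> 3/2 * \<delta> + 2 * \<gamma>" if "adm v" "s \<in> W" for v s
    using U(5)[OF WD(1) adm3, of s v] WD(4)[of s] a_lower that by (simp add: a_def)
  have adm_minus: "adm (- v)" if "adm v" for v
    using that by (simp add: adm_def)
  define A where "A = (1 / b) *\<^sub>R (T o\<^sub>L H)"
  have A: "apply_C0 (A v) s = apply_C0 (T (H v)) s / b" for v s
    by (simp add: A_def blinfun.scaleR_left)
  obtain T' V where T': "norm T' \<le> 1" "norm (T' - T) \<le> 4 * \<delta>" "open V" "t \<in> V" "V \<subseteq> W"
    "\<And>v s. s \<in> V \<Longrightarrow> apply_C0 (T' v) s = apply_C0 (A v) s"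
  proof (rule replace_operator_locally[OF lc W U(1), of "4 * \<delta>" A])
    fix v :: "'s C0" and s assume v: "norm v \<le> 1" and s: "s \<in> W"
    have THv: "\<bar>apply_C0 (T (H v)) s\<bar> \<le> b"
      using TH[OF unit[OF v] s] TH[OF adm_minus[OF unit[OF v]] s] by (simp add: blinfun.minus_right)
    then show "\<bar>apply_C0 (A v) s\<bar> \<le> 1"
      using b(1) by (simp add: A abs_divide)
    have "\<bar>apply_C0 (T v) s - apply_C0 (T (H v)) s\<bar> \<le> 3/2 * \<delta> + 2 * \<gamma>"
      using near[OF unit[OF v] s] near[OF adm_minus[OF unit[OF v]] s] by (simp add: blinfun.minus_right)
    moreover have "\<bar>apply_C0 (A v) s - apply_C0 (T (H v)) s\<bar> \<le> 3/2 * \<delta>"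
    proof -
      have b1: "\<bar>1 - b\<bar> \<le> 3/2 * \<delta>"
        using b(2,3) \<delta>(1) unfolding \<gamma>_def by linarith
      have "apply_C0 (A v) s - apply_C0 (T (H v)) s = (1 - b) * (apply_C0 (T (H v)) s / b)"
        using b(1) by (simp add: A field_simps)
      also have "\<bar>\<dots>\<bar> = \<bar>1 - b\<bar> * \<bar>apply_C0 (T (H v)) s / b\<bar>"
        by (rule abs_mult)
      also have "\<dots> \<le> (3/2 * \<delta>) * 1"
        using b1 b(1) THv \<delta> by (intro mult_mono) (auto simp: abs_divide)
      finally show ?thesis by simp
    qed
    ultimately show "\<bar>apply_C0 (A v) s - apply_C0 (T v) s\<bar> \<le> 4 * \<delta>"
      using \<delta> unfolding \<gamma>_def by arith
  qed (use \<delta> in auto)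
  have "almost_peaks u (\<delta> / 2) T' V"
    unfolding almost_peaks_def
  proof (intro conjI ballI allI impI)
    show "V \<noteq> {}" using T'(4) by blast
    fix s assume s: "s \<in> V"
    then have sW: "s \<in> W" using T'(5) by blast
    have "3 * \<gamma> \<le> \<delta> / 2 * b"
      using mult_left_mono[OF b(1), of "\<delta> / 2"] \<delta> by (simp add: \<gamma>_def)
    then have "(1 - \<delta> / 2) * b \<le> a s"
      using WD(4)[OF sW] by (simp add: b_def algebra_simps)
    then show "1 - \<delta> / 2 \<le> apply_C0 (T' u) s"
      using b(1) by (simp add: T'(6)[OF s] A a_def le_divide_eq)
    fix v :: "'s C0" assume "\<forall>x. \<bar>apply_C0 u x\<bar> = 1 \<longrightarrow> \<bar>apply_C0 v x\<bar> \<le> 1"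
    then have "adm v" by (simp add: adm_def)
    from TH[OF this sW] show "apply_C0 (T' v) s \<le> 1"
      using b(1) by (simp add: T'(6)[OF s] A)
  qed (use T' in auto)
  with T'(2) that show thesis by blast
qed

section \<open>The limit operator\<close>

text \<open>
  The successive operators \<open>S n\<close> differ by at most \<open>4 \<delta> / 2\<^sup>n\<close>, and \<open>\<parallel>S n u\<parallel> \<ge> 1 - \<delta> / 2\<^sup>n\<close> because the
  sets on which they almost peak are nonempty. The points of these sets need not converge: the norm
  estimate alone passes to the limit.
\<close>
lemma almost_peaks_limit:
  fixes T :: "'s::topological_space C0 \<Rightarrow>\<^sub>L 'k::t2_space C0"
  assumes lc: "locally_compact_space (euclidean :: 'k topology)"
    and T: "almost_peaks u \<delta> T U" and \<delta>: "0 < \<delta>" "\<delta> \<le> 1/6" and u: "norm u \<le> 1"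
  obtains R where "norm (R - T) \<le> 8 * \<delta>" "norm R = 1" "norm (R u) = 1" "norm u = 1"
proof -
  define P where "P n p \<longleftrightarrow> almost_peaks u (\<delta> / 2^n) (fst p) (snd p) \<and> (n = 0 \<longrightarrow> fst p = T)"
    for n and p :: "('s C0 \<Rightarrow>\<^sub>L 'k C0) \<times> 'k set"
  have "\<exists>p. \<forall>n. P n (p n) \<and> norm (fst (p (Suc n)) - fst (p n)) \<le> 4 * (\<delta> / 2^n)"
  proof (rule dependent_nat_choice)
    show "\<exists>p. P 0 p" using T by (auto simp: P_def)
    fix p n assume "P n p"
    then have p: "almost_peaks u (\<delta> / 2^n) (fst p) (snd p)" by (simp add: P_def)
    have "\<delta> / 2^n \<le> \<delta> / 1"
      using \<delta>(1) by (intro divide_left_mono) auto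
    then have small: "0 < \<delta> / 2^n" "\<delta> / 2^n \<le> 1/6"
      using \<delta> by (simp, linarith)
    obtain T' V where "norm (T' - fst p) \<le> 4 * (\<delta> / 2^n)" "almost_peaks u (\<delta> / 2^n / 2) T' V"
      by (rule almost_peaks_improve[OF lc p small])
    then show "\<exists>q. P (Suc n) q \<and> norm (fst q - fst p) \<le> 4 * (\<delta> / 2^n)"
      by (intro exI[of _ "(T', V)"]) (simp add: P_def mult.commute)
  qed
  then obtain p where p: "\<And>n. P n (p n)"
    "\<And>n. norm (fst (p (Suc n)) - fst (p n)) \<le> 4 * (\<delta> / 2^n)"
    by blast
  define S where "S n = fst (p n)" for n
  have peak: "\<exists>V. almost_peaks u (\<delta> / 2^n) (S n) V" for n
    using p(1)[of n] by (auto simp: P_def S_def)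
  have geo: "(\<lambda>n. 4 * \<delta> / 2^n) sums (8 * \<delta>)"
    using sums_mult[OF geometric_sums[of "1/2::real"], of "4 * \<delta>"] by (simp add: power_divide)
  have step: "norm (S (Suc n) - S n) \<le> 4 * \<delta> / 2^n" for n
    using p(2)[of n] by (simp add: S_def)
  have summ: "summable (\<lambda>n. norm (S (Suc n) - S n))"
    using step by (intro summable_comparison_test'[OF sums_summable[OF geo]]) auto
  define R where "R = T + (\<Sum>n. S (Suc n) - S n)"
  have "(\<lambda>n. \<Sum>k<n. S (Suc k) - S k) \<longlonglongrightarrow> (\<Sum>n. S (Suc n) - S n)"
    by (rule summable_LIMSEQ[OF summable_norm_cancel[OF summ]])
  then have "(\<lambda>n. S n - T) \<longlonglongrightarrow> (\<Sum>n. S (Suc n) - S n)"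
    by (simp add: sum_lessThan_telescope) (use p(1)[of 0] in \<open>simp add: S_def P_def\<close>)
  from tendsto_add[OF tendsto_const[of T] this] have lim: "S \<longlonglongrightarrow> R"
    by (simp add: R_def)
  have "norm (R - T) \<le> (\<Sum>n. norm (S (Suc n) - S n))"
    unfolding R_def using summable_norm[OF summ] by simp
  also have "\<dots> \<le> 8 * \<delta>"
    unfolding sums_unique[OF geo] by (intro suminf_le step summ sums_summable[OF geo])
  finally have "norm (R - T) \<le> 8 * \<delta>" .
  moreover have R: "norm R \<le> 1"
    by (rule LIMSEQ_le_const2[OF tendsto_norm[OF lim]])
      (use peak in \<open>auto simp: almost_peaks_def\<close>)
  moreover have "1 \<le> norm (R u)"
  proof (rule LIMSEQ_le)
    show "(\<lambda>n. norm (S n u)) \<longlonglongrightarrow> norm (R u)"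
      by (intro tendsto_intros lim)
    show "(\<lambda>n. 1 - \<delta> / 2^n) \<longlonglongrightarrow> 1"
      using tendsto_diff[OF tendsto_const[of 1] summable_LIMSEQ_zero[OF sums_summable[OF sums_mult[OF geo, of "1/4"]]]]
      by simp
    have "1 - \<delta> / 2^n \<le> norm (S n u)" for n
    proof -
      obtain V t where "almost_peaks u (\<delta> / 2^n) (S n) V" "t \<in> V"
        using peak[of n] by (auto simp: almost_peaks_def)
      then show ?thesis
        using abs_apply_C0_le_norm[of "S n u" t] by (force simp: almost_peaks_def)
    qed
    then show "\<exists>N. \<forall>n\<ge>N. 1 - \<delta> / 2^n \<le> norm (S n u)" by blast
  qed
  moreover have "norm (R u) \<le> norm R * norm u" by (rule norm_blinfun)
  moreover have "norm R * norm u \<le> norm R" "norm R * norm u \<le> norm u"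
    using R u by (auto intro: mult_left_le mult_left_le_one_le)
  ultimately show thesis using u by (intro that[of R]) linarith+
qed

theorem corollary3p8:
  assumes "locally_compact_space (euclidean :: 's::topological_space topology)"
    and "metrizable_space (euclidean :: 's topology)"
    and "locally_compact_space (euclidean :: 'k::t2_space topology)"
  shows "bishop_phelps_bollobas TYPE('s C0) TYPE('k C0)"
  unfolding bishop_phelps_bollobas_def
proof (intro ballI)
  fix \<epsilon> :: real assume "\<epsilon> \<in> {0<..<1}"
  then have \<epsilon>: "0 < \<epsilon>" "\<epsilon> < 1" by auto
  \<comment> \<open>The start costs \<open>\<rho>\<close> and leaves the defect \<open>3 \<rho>\<close>, so that the limit costs \<open>24 \<rho>\<close>.\<close>
  define \<rho> where "\<rho> = \<epsilon> / 30"
  have \<rho>: "0 < \<rho>" "\<rho> < 1" "3 * \<rho> \<le> 1/6" "25 * \<rho> < \<epsilon>"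
    using \<epsilon> by (auto simp: \<rho>_def)
  show "\<exists>\<eta>>0. \<forall>T\<^sub>0 :: 's C0 \<Rightarrow>\<^sub>L 'k C0. \<forall>x\<^sub>0\<in>sphere 0 1.
      norm T\<^sub>0 = 1 \<and> norm (blinfun_apply T\<^sub>0 x\<^sub>0) > 1 - \<eta> \<longrightarrow>
      (\<exists>R :: 's C0 \<Rightarrow>\<^sub>L 'k C0. \<exists>x\<in>sphere 0 1.
        norm R = 1 \<and> norm (blinfun_apply R x) = 1 \<and> norm (x\<^sub>0 - x) < \<epsilon> \<and> norm (T\<^sub>0 - R) < \<epsilon>)"
  proof (intro exI[of _ "\<rho>\<^sup>2"] conjI allI ballI impI)
    fix T :: "'s C0 \<Rightarrow>\<^sub>L 'k C0" and f :: "'s C0"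
    assume f: "f \<in> sphere 0 1" and "norm T = 1 \<and> 1 - \<rho>\<^sup>2 < norm (T f)"
    then have T: "norm T = 1" and Tf: "1 - \<rho>\<^sup>2 < norm (T f)" by auto
    obtain t where t: "1 - \<rho>\<^sup>2 < \<bar>apply_C0 (T f) t\<bar>"
      using Tf norm_C0_leI[of "T f" "1 - \<rho>\<^sup>2"] by (meson not_le)
    \<comment> \<open>The construction expects a positive value at \<open>t\<close>; hence \<open>\<sigma> T\<close> in place of \<open>T\<close>.\<close>
    define \<sigma> where "\<sigma> = sgn (apply_C0 (T f) t)"
    have "\<rho>\<^sup>2 < 1" using \<rho> by (simp add: power_less_one_iff)
    with t have "apply_C0 (T f) t \<noteq> 0" by auto
    then have \<sigma>: "\<bar>\<sigma>\<bar> = 1" "\<sigma> * \<sigma> = 1" by (auto simp: \<sigma>_def abs_sgn_eq sgn_if)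
    have start: "norm (\<sigma> *\<^sub>R T) \<le> 1" "norm f \<le> 1" "1 - \<rho>\<^sup>2 < apply_C0 ((\<sigma> *\<^sub>R T) f) t"
      using T f t \<sigma> by (auto simp: \<sigma>_def blinfun.scaleR_left abs_sgn mult.commute)
    obtain u T' U where u: "norm u \<le> 1" "norm (f - u) \<le> \<rho>" and T': "norm (T' - \<sigma> *\<^sub>R T) \<le> \<rho>"
      "almost_peaks u (3 * \<rho>) T' U"
      by (rule almost_peaks_start[OF assms(3) start(1,2) \<rho>(1,2) start(3)])
    obtain R where R: "norm (R - T') \<le> 8 * (3 * \<rho>)" "norm R = 1" "norm (R u) = 1" "norm u = 1"
      by (rule almost_peaks_limit[OF assms(3) T'(2) _ \<rho>(3) u(1)]) (use \<rho> in auto)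
    have "T - \<sigma> *\<^sub>R R = \<sigma> *\<^sub>R (\<sigma> *\<^sub>R T - R)"
      by (simp add: scaleR_diff_right \<sigma>)
    then have "norm (T - \<sigma> *\<^sub>R R) = norm (\<sigma> *\<^sub>R T - R)"
      by (simp add: \<sigma>)
    also have "\<dots> \<le> norm (R - T') + norm (T' - \<sigma> *\<^sub>R T)"
      using norm_triangle_ineq[of "R - T'" "T' - \<sigma> *\<^sub>R T"] by (simp add: norm_minus_commute)
    also have "\<dots> < \<epsilon>" using R(1) T'(1) \<rho> by linarith
    finally have "norm (T - \<sigma> *\<^sub>R R) < \<epsilon>" .
    moreover have "norm (\<sigma> *\<^sub>R R) = 1" "norm ((\<sigma> *\<^sub>R R) u) = 1"
      using R \<sigma> by (auto simp: blinfun.scaleR_left)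
    moreover have "norm (f - u) < \<epsilon>" using u(2) \<rho> by linarith
    moreover have "u \<in> sphere 0 1" using R(4) by simp
    ultimately show "\<exists>R :: 's C0 \<Rightarrow>\<^sub>L 'k C0. \<exists>x\<in>sphere 0 1.
        norm R = 1 \<and> norm (blinfun_apply R x) = 1 \<and> norm (f - x) < \<epsilon> \<and> norm (T - R) < \<epsilon>"
      by blast
  qed (use \<rho> in simp)
qed

end
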